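(* Let $\vec S$ be a separation system and $\mathcal P$ a collection of consistent orientations of $\vec S$ such that $\vec S$ is $\mathcal P$-submodular. Then there is a nested set $N=N(\vec S,\mathcal P)\subseteq S$ which distinguishes $\mathcal P$. This $N(\vec S,\mathcal P)$ can be chosen canonically: if $\varphi\colon\vec S\to\vec S'$ is an isomorphism of separation systems and $\mathcal P':=\{\varphi(P)\mid P\in\mathcal P\}$, then $\varphi(N(\vec S,\mathcal P))=N(\vec S',\mathcal P')$.
   Context: A separation system $\vec S=(\vec S,\le,{}^* )$ is a poset $(\vec S,\le)$ together with an order-reversing involution ${}^*$ on $\vec S$, so $\vec r\le\vec s$ if and only if $\vec s^{\,*}\le\vec r^{\,*}$. Elements $\vec s\in\vec S$ are called oriented separations; $\vec s^{\,*}$ is the inverse of $\vec s$; the underlying unoriented separation is $s=\{\vec s,\vec s^{\,*}\}$, whose orientations are $\vec s$ and $\vec s^{\,*}$. $S$ denotes the set of all unoriented separations $s$ with $\vec s\in\vec S$. Two unoriented separations $r,s$ are nested if they have orientations $\vec r,\vec s$ with $\vec r\le\vec s$; otherwise they cross. Oriented separations are nested (cross) if their underlying unoriented separations do. A set of separations is nested if its elements are pairwise nested. An orientation of $\vec S$ (or of $S$) is a set $O\subseteq\vec S$ containing exactly one orientation $\vec s$ or $\vec s^{\,*}$ of each $s=\{\vec s,\vec s^{\,*}\}\in S$. It is consistent if there are no $\vec r,\vec s\in O$ with $r\ne s$ and $\vec r^{\,*}\le\vec s$. For $\vec r,\vec s\in\vec S$, write $\vec r\vee\vec s$ and $\vec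 r\wedge\vec s$ for the supremum and infimum of $\{\vec r,\vec s\}$ in the poset $\vec S$, if they exist. If $\vec r\vee\vec s$ exists in $\vec S$ and every $P\in\mathcal P$ containing both $\vec r$ and $\vec s$ also contains $\vec r\vee\vec s$, then $\vec r\vee\vec s$ is a $\mathcal P$-join of $\vec r$ and $\vec s$. If $\vec r\wedge\vec s$ exists in $\vec S$ and every $P\in\mathcal P$ containing both $\vec r^{\,*}$ and $\vec s^{\,*}$ also contains $(\vec r\wedge\vec s)^*$, then $\vec r\wedge\vec s$ is a $\mathcal P$-meet of $\vec r$ and $\vec s$. $\vec S$ is $\mathcal P$-submodular if every two crossing $\vec r,\vec s\in\vec S$ have a $\mathcal P$-join or a $\mathcal P$-meet in $\vec S$. (This property is preserved by isomorphisms: $\vec S'$ in the claim is $\mathcal P'$-submodular.) A separation $s\in S$ distinguishes two orientations $P,Q$ of $S$ if it has an orientation $\vec s$ with $\vec s\in P$ and $\vec s^{\,*}\in Q$. A set $N\subseteq S$ distinguishes $\mathcal P$ if every pair of distinct elements of $\mathcal P$ is distinguished by some $s\in N$. An isomorphism of separation systems $\vec S,\vec S'$ is a bijection $\varphi\colon\vec S\to\vec S'$ with $\varphi(\vec s^{\,*})=\varphi(\vec s)^*$ for all $\vec s\in\vec S$, and $\vec r\le\vec s\iff\varphi(\vec r)\le\varphi(\vec s)$ for all $\vec r,\vec s\in\vec S$. It acts on unoriented separations by $\varphi(s)=\{\varphi(\vec s),\varphi(\vec s^{\,*})\}$, on sets of them elementwise, and $\varphi(P)$ is the image of $P\subseteq\vec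 S$. The notation $N(\vec S,\mathcal P)$ indicates that the set depends only on $\vec S$ and $\mathcal P$.
   Formalization: The separation systems are assumed to be finite; without this the claim fails, e.g. for two disjoint, mutually inverse copies of the lattice of integer pairs with a least and a greatest element added, where translations rule out a canonical nested set. *)

theory Defs
  imports Main
begin

text \<open>
  A separation system lives on a carrier set inside an ambient type. The values of the involution
  outside the carrier are irrelevant; the order is a subset of the square of the carrier.
\<close>

record 'a sep_system =
  seps :: "'a set"
  sle :: "'a rel"
  sinv :: "'a \<Rightarrow> 'a"

definition separation_system :: "'a sep_system \<Rightarrow> bool" where
  "separation_system S \<longleftrightarrow>
     partial_order_on (seps S) (sle S) \<and>
     (\<forall>s\<in>seps S. sinv S s \<in> seps S \<and> sinv S (sinv S s) = s) \<and>
     (\<forall>r\<in>seps S. \<forall>s\<in>seps S. (r, s) \<in> sle S \<longleftrightarrow> (sinv S s, sinv S r) \<in> sle S)"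

definition unoriented :: "'a sep_system \<Rightarrow> 'a \<Rightarrow> 'a set" where
  "unoriented S s = {s, sinv S s}"

definition unoriented_seps :: "'a sep_system \<Rightarrow> 'a set set" where
  "unoriented_seps S = unoriented S ` seps S"

text \<open>The orientations of an unoriented separation are its elements.\<close>

definition nested :: "'a sep_system \<Rightarrow> 'a set \<Rightarrow> 'a set \<Rightarrow> bool" where
  "nested S r s \<longleftrightarrow> (\<exists>a\<in>r. \<exists>b\<in>s. (a, b) \<in> sle S)"

definition crossing :: "'a sep_system \<Rightarrow> 'a \<Rightarrow> 'a \<Rightarrow> bool" where
  "crossing S r s \<longleftrightarrow> \<not> nested S (unoriented S r) (unoriented S s)"

definition nested_set :: "'a sep_system \<Rightarrow> 'a set set \<Rightarrow> bool" where
  "nested_set S N \<longleftrightarrow> (\<forall>r\<in>N. \<forall>s\<in>N. nested S r s)"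

definition orientation :: "'a sep_system \<Rightarrow> 'a set \<Rightarrow> bool" where
  "orientation S P \<longleftrightarrow> P \<subseteq> seps S \<and> (\<forall>s\<in>unoriented_seps S. \<exists>!a. a \<in> s \<and> a \<in> P)"

definition consistent :: "'a sep_system \<Rightarrow> 'a set \<Rightarrow> bool" where
  "consistent S P \<longleftrightarrow>
     \<not> (\<exists>r\<in>P. \<exists>s\<in>P. unoriented S r \<noteq> unoriented S s \<and> (sinv S r, s) \<in> sle S)"

definition is_join :: "'a sep_system \<Rightarrow> 'a \<Rightarrow> 'a \<Rightarrow> 'a \<Rightarrow> bool" where
  "is_join S r s j \<longleftrightarrow>
     j \<in> seps S \<and> (r, j) \<in> sle S \<and> (s, j) \<in> sle S \<and>
     (\<forall>u\<in>seps S. (r, u) \<in> sle S \<and> (s, u) \<in> sle S \<longrightarrow> (j, u) \<in> sle S)"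

definition is_meet :: "'a sep_system \<Rightarrow> 'a \<Rightarrow> 'a \<Rightarrow> 'a \<Rightarrow> bool" where
  "is_meet S r s m \<longleftrightarrow>
     m \<in> seps S \<and> (m, r) \<in> sle S \<and> (m, s) \<in> sle S \<and>
     (\<forall>u\<in>seps S. (u, r) \<in> sle S \<and> (u, s) \<in> sle S \<longrightarrow> (u, m) \<in> sle S)"

definition profile_join ::
    "'a sep_system \<Rightarrow> 'a set set \<Rightarrow> 'a \<Rightarrow> 'a \<Rightarrow> 'a \<Rightarrow> bool" where
  "profile_join S \<P> r s j \<longleftrightarrow>
     is_join S r s j \<and> (\<forall>P\<in>\<P>. r \<in> P \<and> s \<in> P \<longrightarrow> j \<in> P)"

definition profile_meet ::
    "'a sep_system \<Rightarrow> 'a set set \<Rightarrow> 'a \<Rightarrow> 'a \<Rightarrow> 'a \<Rightarrow> bool" where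
  "profile_meet S \<P> r s m \<longleftrightarrow>
     is_meet S r s m \<and> (\<forall>P\<in>\<P>. sinv S r \<in> P \<and> sinv S s \<in> P \<longrightarrow> sinv S m \<in> P)"

definition submodular :: "'a sep_system \<Rightarrow> 'a set set \<Rightarrow> bool" where
  "submodular S \<P> \<longleftrightarrow>
     (\<forall>r\<in>seps S. \<forall>s\<in>seps S. crossing S r s \<longrightarrow>
        (\<exists>j. profile_join S \<P> r s j) \<or> (\<exists>m. profile_meet S \<P> r s m))"

definition distinguishes :: "'a sep_system \<Rightarrow> 'a set \<Rightarrow> 'a set \<Rightarrow> 'a set \<Rightarrow> bool" where
  "distinguishes S s P Q \<longleftrightarrow> (\<exists>a\<in>s. a \<in> P \<and> sinv S a \<in> Q)"

definition distinguishes_all :: "'a sep_system \<Rightarrow> 'a set set \<Rightarrow> 'a set set \<Rightarrow> bool" where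
  "distinguishes_all S N \<P> \<longleftrightarrow>
     (\<forall>P\<in>\<P>. \<forall>Q\<in>\<P>. P \<noteq> Q \<longrightarrow> (\<exists>s\<in>N. distinguishes S s P Q))"

definition sep_iso :: "('a \<Rightarrow> 'b) \<Rightarrow> 'a sep_system \<Rightarrow> 'b sep_system \<Rightarrow> bool" where
  "sep_iso \<phi> S S' \<longleftrightarrow>
     bij_betw \<phi> (seps S) (seps S') \<and>
     (\<forall>s\<in>seps S. \<phi> (sinv S s) = sinv S' (\<phi> s)) \<and>
     (\<forall>r\<in>seps S. \<forall>s\<in>seps S. (r, s) \<in> sle S \<longleftrightarrow> (\<phi> r, \<phi> s) \<in> sle S')"

text \<open>
  Finiteness cannot be dropped. In the two disjoint copies \<open>L\<close> and \<open>L*\<close> of the lattice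
  \<open>\<int> \<times> \<int>\<close>, the second one with reversed order and with no relations between the copies, together
  with a least element \<open>0\<close> and a greatest element \<open>0*\<close>, the orientations \<open>L \<union> {0}\<close> and
  \<open>L* \<union> {0}\<close> can only be distinguished by elements of \<open>L\<close> and \<open>L*\<close>; the translations are
  automorphisms that fix both orientations, so a canonical choice would have to contain all these
  separations, among them crossing ones.
\<close>

definition submodular_instance :: "'a sep_system \<Rightarrow> 'a set set \<Rightarrow> bool" where
  "submodular_instance S \<P> \<longleftrightarrow>
     separation_system S \<and> finite (seps S) \<and>
     (\<forall>P\<in>\<P>. orientation S P \<and> consistent S P) \<and>
     submodular S \<P>"

definition nested_distinguishing_choice ::
    "('a sep_system \<Rightarrow> 'a set set \<Rightarrow> 'a set set) \<Rightarrow> bool" where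
  "nested_distinguishing_choice N \<longleftrightarrow>
     (\<forall>S \<P>. submodular_instance S \<P> \<longrightarrow>
        N S \<P> \<subseteq> unoriented_seps S \<and> nested_set S (N S \<P>) \<and> distinguishes_all S (N S \<P>) \<P>)"

text \<open>
  A choice on systems over \<open>'a\<close> and one on systems over \<open>'b\<close> are compatible with all isomorphisms
  from the former to the latter. For one type and \<open>N' = N\<close> this says that \<open>N\<close> is canonical.
  Since a bound variable has a single type, one choice for all systems is expressed by its
  restrictions \<open>N\<close> and \<open>N'\<close> to systems over two arbitrary ambient types that are compatible
  with each other and with themselves.
\<close>

definition iso_compatible ::
    "('a sep_system \<Rightarrow> 'a set set \<Rightarrow> 'a set set) \<Rightarrow>
     ('b sep_system \<Rightarrow> 'b set set \<Rightarrow> 'b set set) \<Rightarrow> bool" where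
  "iso_compatible N N' \<longleftrightarrow>
     (\<forall>S \<P> S' \<phi>. submodular_instance S \<P> \<and> separation_system S' \<and> sep_iso \<phi> S S' \<longrightarrow>
        (\<lambda>s. \<phi> ` s) ` N S \<P> = N' S' ((\<lambda>P. \<phi> ` P) ` \<P>))"

end

theory Submission
  imports Defs
begin

text \<open>
  Call a separation exclusive for an orientation in \<open>\<P>\<close> if it lies in that orientation and in no
  other member of \<open>\<P>\<close>. In a nested set that distinguishes \<open>\<P>\<close>, drawn as a tree, the exclusive
  separations point to the leaves. The construction reads off the leaves, discards them, and
  repeats; every step is invariant under isomorphisms, so the result is canonical.

  Two maximal exclusive separations of one orientation \<open>P\<close> may cross, so there is no canonical
  choice among them. But if they cross, submodularity offers either their supremum or their infimum
  as a further exclusive separation, and maximality excludes the supremum. Hence the infimum of all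
  maximal exclusive separations of \<open>P\<close> exists and is again exclusive (\<open>exclusive_inf_exists\<close>). It is
  canonical and distinguishes \<open>P\<close> from every other member of \<open>\<P>\<close>. For distinct \<open>P\<close> and \<open>Q\<close>,
  maximality forces every maximal exclusive separation of \<open>P\<close> to be nested with every one of \<open>Q\<close>,
  always in the same way (\<open>max_exclusive_towards\<close>), and this passes to the infima. So these infima
  form a nested set.

  They also leave room for the rest. If neither \<open>P\<close> nor \<open>Q\<close> has an exclusive separation, then a
  separation that distinguishes them can be pushed off all the infima, by repeatedly replacing it
  by a supremum (\<open>distinguished_towards_max_exclusive\<close>, \<open>distinguished_by_nested_part\<close>). The
  separations nested with all infima inherit submodularity, because a supremum of two crossing
  separations is nested with everything that both are nested with (\<open>join_of_crossing_nested\<close>).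
  So the construction can be repeated with these separations and with the orientations that have no
  exclusive separation.

  Each repetition deals with fewer orientations, because at least two members of \<open>\<P>\<close> have
  exclusive separations as soon as \<open>\<P>\<close> has two members (\<open>two_exclusive\<close>). This is proved by deleting a member of
  \<open>\<P>\<close>. By induction two others then have exclusive separations; the deleted orientation can contain
  only one of the corresponding maximal ones, by consistency.
\<close>

section \<open>Separation systems\<close>

locale sep_sys =
  fixes S :: "'a sep_system"
  assumes sep_sys: "separation_system S"
begin

abbreviation le (infix "\<preceq>" 50) where "r \<preceq> s \<equiv> (r, s) \<in> sle S"

abbreviation star ("(_\<^sup>\<star>)" [1000] 1000) where "s\<^sup>\<star> \<equiv> sinv S s"

lemma le_refl: "s \<in> seps S \<Longrightarrow> s \<preceq> s"
  using sep_sys by (auto simp: separation_system_def partial_order_on_def preorder_on_def refl_on_def)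

lemma le_trans: "r \<preceq> s \<Longrightarrow> s \<preceq> t \<Longrightarrow> r \<preceq> t"
  using sep_sys by (auto simp: separation_system_def partial_order_on_def preorder_on_def dest: transD)

lemma le_antisym: "r \<preceq> s \<Longrightarrow> s \<preceq> r \<Longrightarrow> r = s"
  using sep_sys by (auto simp: separation_system_def partial_order_on_def dest: antisymD)

lemma le_carrier: "r \<preceq> s \<Longrightarrow> r \<in> seps S \<and> s \<in> seps S"
  using sep_sys
  by (auto simp: separation_system_def partial_order_on_def preorder_on_def refl_on_def)

lemma star_in [simp]: "s \<in> seps S \<Longrightarrow> s\<^sup>\<star> \<in> seps S"
  and star_star [simp]: "s \<in> seps S \<Longrightarrow> s\<^sup>\<star>\<^sup>\<star> = s"
  using sep_sys unfolding separation_system_def by blast+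

lemma star_le_star: "r \<in> seps S \<Longrightarrow> s \<in> seps S \<Longrightarrow> r\<^sup>\<star> \<preceq> s\<^sup>\<star> \<longleftrightarrow> s \<preceq> r"
  using sep_sys unfolding separation_system_def by blast

lemma star_le: "r \<in> seps S \<Longrightarrow> s \<in> seps S \<Longrightarrow> r\<^sup>\<star> \<preceq> s \<longleftrightarrow> s\<^sup>\<star> \<preceq> r"
  using star_le_star[of r "s\<^sup>\<star>"] by simp

lemma le_star: "r \<in> seps S \<Longrightarrow> s \<in> seps S \<Longrightarrow> r \<preceq> s\<^sup>\<star> \<longleftrightarrow> s \<preceq> r\<^sup>\<star>"
  using star_le_star[of "r\<^sup>\<star>" s] by simp

lemma crossing_iff:
  assumes "r \<in> seps S" "s \<in> seps S"
  shows "crossing S r s \<longleftrightarrow> \<not> (r \<preceq> s \<or> s \<preceq> r \<or> r \<preceq> s\<^sup>\<star> \<or> r\<^sup>\<star> \<preceq> s)"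
  using assms by (auto simp: crossing_def nested_def unoriented_def star_le_star)

lemma crossing_star [simp]:
  assumes "r \<in> seps S" "s \<in> seps S"
  shows "crossing S (r\<^sup>\<star>) s \<longleftrightarrow> crossing S r s" "crossing S r (s\<^sup>\<star>) \<longleftrightarrow> crossing S r s"
  using assms by (auto simp: crossing_def nested_def unoriented_def)

lemma crossing_commute:
  assumes "r \<in> seps S" "s \<in> seps S"
  shows "crossing S r s \<longleftrightarrow> crossing S s r"
  using crossing_iff[OF assms] crossing_iff[OF assms(2,1)] star_le[OF assms] le_star[OF assms] by blast

text \<open>
  The key fact behind passing to a subsystem: suprema of crossing separations do not leave the set
  of separations nested with a given one.
\<close>

lemma join_of_crossing_nested:
  assumes "is_join S r s j" "crossing S r s" "r \<in> seps S" "s \<in> seps S" "t \<in> seps S"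
    and "\<not> crossing S r t" "\<not> crossing S s t"
  shows "\<not> crossing S j t"
proof -
  have j: "j \<in> seps S" "r \<preceq> j" "s \<preceq> j"
    and least: "\<And>u. r \<preceq> u \<Longrightarrow> s \<preceq> u \<Longrightarrow> j \<preceq> u"
    using assms(1) le_carrier unfolding is_join_def by blast+
  have above: "\<not> crossing S j t"
    if "t \<preceq> j \<or> t\<^sup>\<star> \<preceq> j \<or> j \<preceq> t \<or> j \<preceq> t\<^sup>\<star>"
    using that assms(5) j(1) star_le[of t j] by (auto simp: crossing_iff)
  have rt: "t \<preceq> r \<or> t\<^sup>\<star> \<preceq> r \<or> r \<preceq> t \<or> r \<preceq> t\<^sup>\<star>"
    using assms(3,5,6) star_le[of t r] by (auto simp: crossing_iff)
  have st: "t \<preceq> s \<or> t\<^sup>\<star> \<preceq> s \<or> s \<preceq> t \<or> s \<preceq> t\<^sup>\<star>"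
    using assms(4,5,7) star_le[of t s] by (auto simp: crossing_iff)
  \<comment> \<open>If both are below \<open>t\<close>, or both below its inverse, so is the join; if they are below
      different orientations, they are nested with each other.\<close>
  have "\<not> (r \<preceq> t \<and> s \<preceq> t\<^sup>\<star>)" "\<not> (r \<preceq> t\<^sup>\<star> \<and> s \<preceq> t)"
    using assms(2-5) le_star le_trans by (meson crossing_iff)+
  then show ?thesis
    using rt st above j least le_trans by blast
qed

text \<open>
  The involution turns infima into suprema, so that the arguments below need only suprema.
\<close>

lemma profile_meet_iff_join:
  assumes "r \<in> seps S" "s \<in> seps S" "m \<in> seps S"
  shows "profile_meet S \<P> r s m \<longleftrightarrow> profile_join S \<P> (r\<^sup>\<star>) (s\<^sup>\<star>) (m\<^sup>\<star>)"
proof -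
  have "(\<forall>u\<in>seps S. u \<preceq> r \<and> u \<preceq> s \<longrightarrow> u \<preceq> m) \<longleftrightarrow>
        (\<forall>u\<in>seps S. r\<^sup>\<star> \<preceq> u \<and> s\<^sup>\<star> \<preceq> u \<longrightarrow> m\<^sup>\<star> \<preceq> u)" (is "?A \<longleftrightarrow> ?B")
  proof
    assume ?A
    then show ?B using assms star_le star_in by metis
  next
    assume B: ?B
    show ?A
    proof (intro ballI impI)
      fix u assume "u \<in> seps S" "u \<preceq> r \<and> u \<preceq> s"
      then show "u \<preceq> m"
        using B[rule_format, of "u\<^sup>\<star>"] assms by (simp add: star_le_star)
    qed
  qed
  then show ?thesis
    using assms by (simp add: profile_meet_def profile_join_def is_meet_def is_join_def star_le_star)
qed

lemma submodular_iff_joins: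
  "submodular S \<P> \<longleftrightarrow> (\<forall>r\<in>seps S. \<forall>s\<in>seps S. crossing S r s \<longrightarrow>
     (\<exists>j. profile_join S \<P> r s j) \<or> (\<exists>j. profile_join S \<P> (r\<^sup>\<star>) (s\<^sup>\<star>) j))"
proof -
  have "(\<exists>m. profile_meet S \<P> r s m) \<longleftrightarrow> (\<exists>j. profile_join S \<P> (r\<^sup>\<star>) (s\<^sup>\<star>) j)"
    if "r \<in> seps S" "s \<in> seps S" for r s
  proof
    assume "\<exists>m. profile_meet S \<P> r s m"
    then show "\<exists>j. profile_join S \<P> (r\<^sup>\<star>) (s\<^sup>\<star>) j"
      using that profile_meet_iff_join by (metis profile_meet_def is_meet_def)
  next
    assume "\<exists>j. profile_join S \<P> (r\<^sup>\<star>) (s\<^sup>\<star>) j"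
    then obtain j where j: "profile_join S \<P> (r\<^sup>\<star>) (s\<^sup>\<star>) j" by blast
    then have "j \<in> seps S" by (simp add: profile_join_def is_join_def)
    then show "\<exists>m. profile_meet S \<P> r s m"
      using j that profile_meet_iff_join[of r s "j\<^sup>\<star>"] by auto
  qed
  then show ?thesis unfolding submodular_def by auto
qed

end

section \<open>Exclusive separations\<close>

definition exclusive :: "'a sep_system \<Rightarrow> 'a set set \<Rightarrow> 'a set \<Rightarrow> 'a set" where
  "exclusive S \<P> P = {s \<in> P. \<forall>Q\<in>\<P>. s \<in> Q \<longrightarrow> Q = P}"

definition max_exclusive :: "'a sep_system \<Rightarrow> 'a set set \<Rightarrow> 'a set \<Rightarrow> 'a set" where
  "max_exclusive S \<P> P =
     {r \<in> exclusive S \<P> P. \<forall>s\<in>exclusive S \<P> P. (r, s) \<in> sle S \<longrightarrow> s = r}"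

definition exclusive_inf :: "'a sep_system \<Rightarrow> 'a set set \<Rightarrow> 'a set \<Rightarrow> 'a \<Rightarrow> bool" where
  "exclusive_inf S \<P> P m \<longleftrightarrow>
     m \<in> exclusive S \<P> P \<and> (\<forall>r\<in>max_exclusive S \<P> P. (m, r) \<in> sle S) \<and>
     (\<forall>u\<in>seps S. (\<forall>r\<in>max_exclusive S \<P> P. (u, r) \<in> sle S) \<longrightarrow> (u, m) \<in> sle S)"

locale submodular_family = sep_sys +
  fixes \<P> :: "'a set set"
  assumes inst: "submodular_instance S \<P>"
begin

abbreviation "E \<equiv> exclusive S \<P>"
abbreviation "M \<equiv> max_exclusive S \<P>"

lemma finite_seps: "finite (seps S)"
  using inst by (simp add: submodular_instance_def)

lemma mem_seps: "P \<in> \<P> \<Longrightarrow> s \<in> P \<Longrightarrow> s \<in> seps S"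
  using inst by (auto simp: submodular_instance_def orientation_def)

lemma finite_family: "finite \<P>"
  using finite_seps mem_seps by (intro finite_subset[of \<P> "Pow (seps S)"]) auto

lemma star_mem_iff:
  assumes "P \<in> \<P>" "s \<in> seps S"
  shows "s\<^sup>\<star> \<in> P \<longleftrightarrow> s \<notin> P \<or> s = s\<^sup>\<star>"
proof -
  have "\<exists>!a. a \<in> {s, s\<^sup>\<star>} \<and> a \<in> P"
    using inst assms unfolding submodular_instance_def orientation_def unoriented_seps_def
    by (auto simp: unoriented_def)
  then show ?thesis by (metis insertCI insertE singletonD)
qed

text \<open>
  The exception is genuine: the orientation may contain a separation whose inverse lies below it,
  since consistency does not restrict the two orientations of one separation.
\<close>

lemma down_closed:
  assumes "P \<in> \<P>" "s \<in> P" "r \<preceq> s"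
  shows "r \<in> P \<or> r = s\<^sup>\<star>"
proof (rule disjCI)
  assume ne: "r \<noteq> s\<^sup>\<star>"
  have c: "r \<in> seps S" "s \<in> seps S" using assms le_carrier by auto
  show "r \<in> P"
  proof (rule ccontr)
    assume "r \<notin> P"
    then have rP: "r\<^sup>\<star> \<in> P" using star_mem_iff assms(1) c(1) by blast
    have "consistent S P" using inst assms(1) by (simp add: submodular_instance_def)
    then have "unoriented S (r\<^sup>\<star>) = unoriented S s"
      using rP assms(2,3) star_star[OF c(1)] unfolding consistent_def by metis
    then have "r\<^sup>\<star> = s \<or> r = s" using c unfolding unoriented_def by (auto simp: doubleton_eq_iff)
    then show False using ne \<open>r \<notin> P\<close> assms(2) c by auto
  qed
qed

lemma crossing_cases:
  assumes "r \<in> seps S" "s \<in> seps S" "crossing S r s"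
  obtains (join) j where "profile_join S \<P> r s j"
  | (join_star) j where "profile_join S \<P> (r\<^sup>\<star>) (s\<^sup>\<star>) j"
  using inst assms submodular_iff_joins unfolding submodular_instance_def by blast

lemma profile_joinD:
  assumes "profile_join S \<P> r s j"
  shows "j \<in> seps S" "r \<preceq> j" "s \<preceq> j" "P \<in> \<P> \<Longrightarrow> r \<in> P \<Longrightarrow> s \<in> P \<Longrightarrow> j \<in> P"
  using assms by (auto simp: profile_join_def is_join_def)

lemma exclusiveD:
  assumes "P \<in> \<P>" "r \<in> E P"
  shows "r \<in> P" "r \<in> seps S" "Q \<in> \<P> \<Longrightarrow> r \<in> Q \<Longrightarrow> Q = P"
    "Q \<in> \<P> \<Longrightarrow> Q \<noteq> P \<Longrightarrow> r\<^sup>\<star> \<in> Q"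
proof -
  show r: "r \<in> P" and only: "Q \<in> \<P> \<Longrightarrow> r \<in> Q \<Longrightarrow> Q = P"
    using assms(2) unfolding exclusive_def by blast+
  show s: "r \<in> seps S" using mem_seps[OF assms(1) r] .
  show "r\<^sup>\<star> \<in> Q" if "Q \<in> \<P>" "Q \<noteq> P"
    using that assms(2) star_mem_iff[OF that(1) s] unfolding exclusive_def by blast
qed

lemma exclusive_upward:
  assumes "P \<in> \<P>" "r \<in> E P" "s \<in> P" "r \<preceq> s"
  shows "s \<in> E P"
proof -
  have "Q = P" if Q: "Q \<in> \<P>" "s \<in> Q" for Q
  proof -
    consider "r \<in> Q" | "r = s\<^sup>\<star>" using down_closed[OF Q assms(4)] by blast
    then show ?thesis
    proof cases
      case 1 then show ?thesis using exclusiveD(3)[OF assms(1,2)] Q by blast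
    next
      case 2
      then have "s = r"
        using star_mem_iff[OF assms(1) mem_seps[OF assms(1,3)]] exclusiveD(1)[OF assms(1,2)] assms(3)
        by simp
      then show ?thesis using Q exclusiveD(3)[OF assms(1,2)] by blast
    qed
  qed
  then show ?thesis using assms(3) unfolding exclusive_def by blast
qed

lemma max_exclusiveD:
  assumes "P \<in> \<P>" "r \<in> M P"
  shows "r \<in> E P" "r \<in> P" "r \<in> seps S" "s \<in> P \<Longrightarrow> r \<preceq> s \<Longrightarrow> s = r"
proof -
  show *: "r \<in> E P" using assms(2) unfolding max_exclusive_def by blast
  show "r \<in> P" "r \<in> seps S" using exclusiveD(1,2)[OF assms(1) *] .
  show "s = r" if "s \<in> P" "r \<preceq> s"
    using exclusive_upward[OF assms(1) * that] that(2) assms(2) unfolding max_exclusive_def by blast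
qed

lemma max_exclusive_nonempty:
  assumes "P \<in> \<P>" "E P \<noteq> {}"
  shows "M P \<noteq> {}"
proof -
  have fin: "finite {u. e \<preceq> u}" for e
    by (rule finite_subset[OF _ finite_seps]) (use le_carrier in blast)
  have "\<exists>r. r \<in> M P" if "e \<in> E P" for e
    using that
  proof (induction "card {u. e \<preceq> u}" arbitrary: e rule: less_induct)
    case less
    show ?case
    proof (cases "e \<in> M P")
      case False
      then obtain f where f: "f \<in> E P" "e \<preceq> f" "f \<noteq> e"
        using less.prems unfolding max_exclusive_def by auto
      have "e \<preceq> e" using exclusiveD(2)[OF assms(1) less.prems] le_refl by blast
      then have "{u. f \<preceq> u} \<subset> {u. e \<preceq> u}"
        using f le_trans le_antisym by blast
      then show ?thesis using less.hyps[OF psubset_card_mono[OF fin]] f(1) by blast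
    qed blast
  qed
  then show ?thesis using assms(2) by blast
qed

text \<open>
  Let \<open>r \<noteq> s\<close>. If \<open>r \<preceq> s\<^sup>\<star>\<close>, then \<open>Q\<close>, which contains both inverses, would be inconsistent; if
  \<open>r\<^sup>\<star> \<preceq> s\<close>, then \<open>P\<close> would be. If \<open>P\<close> were the only orientation, the first case could occur.
\<close>

lemma exclusive_nested_comparable:
  assumes "P \<in> \<P>" "Q \<in> \<P>" "Q \<noteq> P" "r \<in> E P" "s \<in> E P" "\<not> crossing S r s"
  shows "r \<preceq> s \<or> s \<preceq> r"
proof -
  note r = exclusiveD[OF assms(1,4)] and s = exclusiveD[OF assms(1,5)]
  consider "r \<preceq> s" | "s \<preceq> r" | "r \<preceq> s\<^sup>\<star>" | "r\<^sup>\<star> \<preceq> s"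
    using assms(6) crossing_iff r(2) s(2) by blast
  then show ?thesis
  proof cases
    case 3
    then have "r \<in> Q \<or> r = s" using down_closed[OF assms(2) s(4)[OF assms(2,3)]] s(2) by simp
    then show ?thesis using r(3)[OF assms(2)] assms(3) le_refl r(2) by blast
  next
    case 4
    then have "r\<^sup>\<star> \<in> P \<or> r\<^sup>\<star> = s\<^sup>\<star>" using down_closed[OF assms(1) s(1)] by simp
    then have "r\<^sup>\<star> = r \<or> r = s" using star_mem_iff[OF assms(1) r(2)] r(1,2) s(2) by (metis star_star)
    then show ?thesis using 4 le_refl r(2) by auto
  qed auto
qed

text \<open>
  A supremum lies in \<open>P\<close> by submodularity and is exclusive because it is larger. An infimum lies in
  \<open>P\<close> by consistency; it is exclusive because every other orientation contains the inverses of both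
  separations and hence, by submodularity, that of the infimum.
\<close>

lemma exclusive_crossing_cases:
  assumes "P \<in> \<P>" "r \<in> E P" "s \<in> E P" "crossing S r s"
  obtains (join) j where "is_join S r s j" "j \<in> E P"
  | (meet) m where "is_meet S r s m" "m \<in> E P"
proof -
  note r = exclusiveD[OF assms(1,2)] and s = exclusiveD[OF assms(1,3)]
  have nc: "\<not> r \<preceq> s" "\<not> s \<preceq> r" "\<not> r \<preceq> s\<^sup>\<star>" "\<not> r\<^sup>\<star> \<preceq> s"
    using assms(4) crossing_iff r(2) s(2) by auto
  from r(2) s(2) assms(4) show ?thesis
  proof (cases rule: crossing_cases)
    case (join j)
    then show ?thesis using that(1) exclusive_upward[OF assms(1,2)] profile_joinD[OF join] r(1) s(1) assms(1)
      by (metis profile_join_def)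
  next
    case (join_star j)
    define m where "m = j\<^sup>\<star>"
    have m: "m \<in> seps S" "m\<^sup>\<star> = j" using profile_joinD(1)[OF join_star] m_def by auto
    have meet: "is_meet S r s m"
      using profile_meet_iff_join[OF r(2) s(2) m(1), of \<P>] join_star m(2) by (simp add: profile_meet_def)
    have le: "m \<preceq> r" "m \<preceq> s" using meet by (auto simp: is_meet_def)
    have "m \<in> P" using down_closed[OF assms(1) r(1) le(1)] le nc by auto
    moreover have "Q = P" if Q: "Q \<in> \<P>" "m \<in> Q" for Q
    proof (rule ccontr)
      assume "Q \<noteq> P"
      then have "m\<^sup>\<star> \<in> Q" using profile_joinD(4)[OF join_star Q(1)] r(4) s(4) Q(1) m(2) by blast
      then have "m = m\<^sup>\<star>" using star_mem_iff[OF Q(1) m(1)] Q(2) by blast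
      then have "r\<^sup>\<star> \<preceq> m" using le(1) r(2) m(1) star_le_star by metis
      then show False using le(2) nc(4) le_trans by blast
    qed
    ultimately have "m \<in> E P" unfolding exclusive_def by blast
    then show ?thesis using that(2) meet by blast
  qed
qed

text \<open>
  The infimum is built up from one maximal exclusive separation at a time. If the infimum so far
  crosses the next one, \<open>t\<close>, an exclusive supremum of the two would equal \<open>t\<close> by maximality and make
  them comparable, so their infimum is exclusive.
\<close>

lemma exclusive_inf_exists:
  assumes "P \<in> \<P>" "Q \<in> \<P>" "Q \<noteq> P" "E P \<noteq> {}"
  obtains m where "exclusive_inf S \<P> P m"
proof -
  have fin: "finite (M P)"
    using finite_seps max_exclusiveD(3)[OF assms(1)] by (meson finite_subset subsetI)
  have "\<exists>m\<in>E P. (\<forall>r\<in>F. m \<preceq> r) \<and> (\<forall>u\<in>seps S. (\<forall>r\<in>F. u \<preceq> r) \<longrightarrow> u \<preceq> m)"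
    if "finite F" "F \<noteq> {}" "F \<subseteq> M P" for F
    using that
  proof (induction F rule: finite_ne_induct)
    case (singleton r)
    then show ?case using max_exclusiveD(1,3)[OF assms(1)] le_refl by auto
  next
    case (insert t F)
    then obtain m where m: "m \<in> E P" "\<forall>r\<in>F. m \<preceq> r"
      "\<forall>u\<in>seps S. (\<forall>r\<in>F. u \<preceq> r) \<longrightarrow> u \<preceq> m" by auto
    have t: "t \<in> M P" using insert.prems by simp
    note tE = max_exclusiveD[OF assms(1) t]
    have ms: "m \<in> seps S" using exclusiveD(2)[OF assms(1) m(1)] .
    consider "m \<preceq> t" | "t \<preceq> m" | "\<not> m \<preceq> t" "crossing S m t"
      using exclusive_nested_comparable[OF assms(1-3) m(1) tE(1)] by blast
    then show ?case
    proof cases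
      case 1
      then show ?thesis using m by (intro bexI[of _ m]) auto
    next
      case 2
      then show ?thesis using m(2) tE(1,3) le_refl le_trans by (intro bexI[of _ t]) blast+
    next
      case 3
      from assms(1) m(1) tE(1) 3(2) show ?thesis
      proof (cases rule: exclusive_crossing_cases)
        case (join j)
        then have "j = t" using tE(4) exclusiveD(1)[OF assms(1)] unfolding is_join_def by blast
        then show ?thesis using join 3(1) by (auto simp: is_join_def)
      next
        case (meet n)
        then have n: "n \<preceq> m" "n \<preceq> t" "\<forall>u\<in>seps S. u \<preceq> m \<and> u \<preceq> t \<longrightarrow> u \<preceq> n"
          by (auto simp: is_meet_def)
        then show ?thesis using meet(2) m(2,3) le_trans by (intro bexI[of _ n]) blast+
      qed
    qed
  qed
  from this[OF fin max_exclusive_nonempty[OF assms(1,4)] order_refl]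
  show ?thesis using that unfolding exclusive_inf_def by blast
qed

text \<open>
  The separation \<open>s\<^sup>\<star>\<close> lies in \<open>P\<close> and \<open>r\<^sup>\<star>\<close> lies in \<open>Q\<close>. If \<open>r\<close> and \<open>s\<close> cross, then either \<open>r\<close> and
  \<open>s\<^sup>\<star>\<close> have a supremum in \<open>P\<close>, which is \<open>r\<close> by maximality, or \<open>r\<^sup>\<star>\<close> and \<open>s\<close> have one in \<open>Q\<close>,
  which is \<open>s\<close>; so they do not cross. The other ways of being nested contradict
  exclusivity or maximality unless \<open>r = s\<^sup>\<star>\<close>.
\<close>

lemma max_exclusive_towards:
  assumes "P \<in> \<P>" "Q \<in> \<P>" "P \<noteq> Q" "r \<in> M P" "s \<in> M Q"
  shows "r\<^sup>\<star> \<preceq> s"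
proof -
  note r = max_exclusiveD[OF assms(1,4)] and s = max_exclusiveD[OF assms(2,5)]
  note rE = exclusiveD(3,4)[OF assms(1) r(1)] and sE = exclusiveD(3,4)[OF assms(2) s(1)]
  have sP: "s\<^sup>\<star> \<in> P" and rQ: "r\<^sup>\<star> \<in> Q" using rE(2) sE(2) assms by auto
  have opp: ?thesis if "r = s\<^sup>\<star>" using that s(3) le_refl by simp
  show ?thesis
  proof (cases "crossing S r s")
    case True
    then have "crossing S r (s\<^sup>\<star>)" using r(3) s(3) by simp
    with r(3) star_in[OF s(3)] show ?thesis
    proof (cases rule: crossing_cases)
      case (join j)
      note j = profile_joinD[OF join]
      have "j = r" using r(4) j(2) j(4)[OF assms(1) r(2) sP] by blast
      then show ?thesis using j(3) star_le r(3) s(3) by blast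
    next
      case (join_star j)
      then have "profile_join S \<P> (r\<^sup>\<star>) s j" using s(3) by simp
      note j = profile_joinD[OF this]
      have "j = s" using s(4) j(3) j(4)[OF assms(2) rQ s(2)] by blast
      then show ?thesis using j(2) by blast
    qed
  next
    case False
    then consider "r \<preceq> s" | "s \<preceq> r" | "r \<preceq> s\<^sup>\<star>" | "r\<^sup>\<star> \<preceq> s"
      using crossing_iff r(3) s(3) by blast
    then show ?thesis
    proof cases
      case 1
      then show ?thesis using down_closed[OF assms(2) s(2)] rE(1) assms opp by blast
    next
      case 2
      then have "s = r\<^sup>\<star>" using down_closed[OF assms(1) r(2)] sE(1) assms by blast
      then show ?thesis using s(3) le_refl by simp
    next
      case 3
      then show ?thesis using r(4) sP opp by metis
    qed
  qed
qed

lemma max_exclusive_towards_inf: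
  assumes "P \<in> \<P>" "Q \<in> \<P>" "P \<noteq> Q" "r \<in> M P" "exclusive_inf S \<P> Q m"
  shows "r\<^sup>\<star> \<preceq> m"
  using assms max_exclusive_towards max_exclusiveD(3) star_in unfolding exclusive_inf_def by blast

lemma exclusive_inf_not_crossing:
  assumes "P \<in> \<P>" "Q \<in> \<P>" "exclusive_inf S \<P> P m" "exclusive_inf S \<P> Q n"
  shows "\<not> crossing S m n"
proof -
  have m: "m \<in> seps S" and n: "n \<in> seps S"
    using assms exclusiveD(2) unfolding exclusive_inf_def by blast+
  show ?thesis
  proof (cases "P = Q")
    case True
    then have "m \<preceq> n" using assms m unfolding exclusive_inf_def by blast
    then show ?thesis using m n crossing_iff by blast
  next
    case False
    have "n\<^sup>\<star> \<preceq> r" if "r \<in> M P" for r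
      using max_exclusive_towards_inf[OF assms(1,2) False that assms(4)] max_exclusiveD(3)[OF assms(1) that]
        n star_le by blast
    then have "n\<^sup>\<star> \<preceq> m" using assms(3) n unfolding exclusive_inf_def by auto
    then show ?thesis using m n crossing_iff star_le by blast
  qed
qed

end

section \<open>Existence of exclusive separations\<close>

lemma submodular_family_iff: "submodular_family S \<P> \<longleftrightarrow> submodular_instance S \<P>"
  by (auto simp: submodular_family_def submodular_family_axioms_def sep_sys_def submodular_instance_def)

lemma submodular_instance_subset:
  assumes "submodular_instance S \<P>" "\<Q> \<subseteq> \<P>"
  shows "submodular_instance S \<Q>"
proof -
  have mono: "profile_join S \<P> r s j \<Longrightarrow> profile_join S \<Q> r s j"
    "profile_meet S \<P> r s j \<Longrightarrow> profile_meet S \<Q> r s j" for r s j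
    using assms(2) unfolding profile_join_def profile_meet_def by blast+
  have "submodular S \<Q>"
    unfolding submodular_def
  proof (intro ballI impI)
    fix r s assume "r \<in> seps S" "s \<in> seps S" "crossing S r s"
    then have "(\<exists>j. profile_join S \<P> r s j) \<or> (\<exists>m. profile_meet S \<P> r s m)"
      using assms(1) unfolding submodular_instance_def submodular_def by blast
    then show "(\<exists>j. profile_join S \<Q> r s j) \<or> (\<exists>m. profile_meet S \<Q> r s m)"
      using mono by blast
  qed
  then show ?thesis using assms unfolding submodular_instance_def by blast
qed

context submodular_family
begin

text \<open>
  Maximal separations exclusive for \<open>P\<close> and \<open>Q\<close> among the members of \<open>\<P>\<close> other than \<open>R\<close> satisfy
  \<open>r\<^sup>\<star> \<preceq> s\<close>, so a consistent \<open>R\<close> does not contain both. The one outside \<open>R\<close> remains exclusive.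
\<close>

lemma exclusive_survives:
  assumes "R \<in> \<P>" "P \<in> \<P>" "Q \<in> \<P>" "P \<noteq> R" "Q \<noteq> R" "P \<noteq> Q"
    and "exclusive S (\<P> - {R}) P \<noteq> {}" "exclusive S (\<P> - {R}) Q \<noteq> {}"
  shows "E P \<noteq> {} \<or> E Q \<noteq> {}"
proof -
  interpret R: submodular_family S "\<P> - {R}"
    using submodular_instance_subset[OF inst] by (simp add: submodular_family_iff)
  have P: "P \<in> \<P> - {R}" and Q: "Q \<in> \<P> - {R}" using assms by auto
  obtain r where r: "r \<in> R.M P" using R.max_exclusive_nonempty[OF P assms(7)] by auto
  obtain s where s: "s \<in> R.M Q" using R.max_exclusive_nonempty[OF Q assms(8)] by auto
  note rD = R.max_exclusiveD[OF P r] and sD = R.max_exclusiveD[OF Q s]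
  have le: "r\<^sup>\<star> \<preceq> s" using R.max_exclusive_towards[OF P Q assms(6) r s] .
  have "\<not> (r \<in> R \<and> s \<in> R)"
  proof
    assume "r \<in> R \<and> s \<in> R"
    then have rR: "r \<in> R" and "r\<^sup>\<star> \<in> R \<or> r\<^sup>\<star> = s\<^sup>\<star>" using down_closed[OF assms(1) _ le] by blast+
    then have "r = r\<^sup>\<star> \<or> r\<^sup>\<star>\<^sup>\<star> = s\<^sup>\<star>\<^sup>\<star>"
      using star_mem_iff[OF assms(1) rD(3)] by metis
    then have "r = r\<^sup>\<star> \<or> r = s" using rD(3) sD(3) by simp
    moreover have "r \<notin> Q" "r\<^sup>\<star> \<in> Q" using R.exclusiveD(3,4)[OF P rD(1) Q] assms(6) by blast+
    ultimately show False using sD(2) by metis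
  qed
  moreover have "r \<notin> R \<Longrightarrow> r \<in> E P" "s \<notin> R \<Longrightarrow> s \<in> E Q"
    using rD(1) sD(1) unfolding exclusive_def by blast+
  ultimately show ?thesis by blast
qed

end

text \<open>
  Deleting any member \<open>R\<close> yields, by induction, an orientation other than \<open>R\<close> that has an exclusive
  separation. Doing this a second time with that orientation in the role of \<open>R\<close> yields another one.
\<close>

lemma two_exclusive:
  assumes "submodular_instance S \<P>" "P \<in> \<P>" "Q \<in> \<P>" "P \<noteq> Q"
  shows "\<exists>X\<in>\<P>. \<exists>Y\<in>\<P>. X \<noteq> Y \<and> exclusive S \<P> X \<noteq> {} \<and> exclusive S \<P> Y \<noteq> {}"
  using assms
proof (induction "card \<P>" arbitrary: \<P> P Q rule: less_induct)
  case less
  interpret submodular_family S \<P> using less.prems by (simp add: submodular_family_iff)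
  show ?case
  proof (cases "\<P> = {P, Q}")
    case True
    have PQ: "P - Q \<subseteq> E P" "Q - P \<subseteq> E Q" using True by (auto simp: exclusive_def)
    have "X = Y" if "X \<in> \<P>" "Y \<in> \<P>" "X \<subseteq> Y" for X Y
    proof (rule subset_antisym[OF that(3)], rule subsetI, rule ccontr)
      fix y assume y: "y \<in> Y" "y \<notin> X"
      have ys: "y \<in> seps S" using mem_seps[OF that(2) y(1)] .
      then have "y\<^sup>\<star> \<in> X" using star_mem_iff[OF that(1) ys] y(2) by blast
      moreover from this have "y = y\<^sup>\<star>" using star_mem_iff[OF that(2) ys] y(1) that(3) by blast
      ultimately show False using y(2) by simp
    qed
    then have "P - Q \<noteq> {}" "Q - P \<noteq> {}"
      using less.prems by blast+
    then show ?thesis using PQ less.prems by blast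
  next
    case False
    have one: "\<exists>X\<in>\<P>. X \<noteq> R \<and> E X \<noteq> {}" if R: "R \<in> \<P>" for R
    proof -
      have small: "card (\<P> - {R}) < card \<P>"
        using R finite_family by (meson card_Diff1_less)
      obtain C where C: "C \<in> \<P>" "C \<noteq> P" "C \<noteq> Q" using False less.prems(2,3) by blast
      obtain A B where AB: "A \<in> \<P> - {R}" "B \<in> \<P> - {R}" "A \<noteq> B"
      proof (cases "C = R")
        case True
        then show ?thesis using that[of P Q] C less.prems(2-4) by simp
      next
        case False
        then show ?thesis using that[of C P] that[of C Q] C less.prems(2-4) by (cases "P = R") simp_all
      qed
      from less.hyps[OF small submodular_instance_subset[OF inst Diff_subset] AB]
      obtain X Y where "X \<in> \<P> - {R}" "Y \<in> \<P> - {R}" "X \<noteq> Y"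
        "exclusive S (\<P> - {R}) X \<noteq> {}" "exclusive S (\<P> - {R}) Y \<noteq> {}" by blast
      then show ?thesis using exclusive_survives[OF R, of X Y] by blast
    qed
    obtain X where X: "X \<in> \<P>" "E X \<noteq> {}" using one[OF less.prems(2)] by blast
    then show ?thesis using one[OF X(1)] by blast
  qed
qed

section \<open>Passing to the separations nested with the infima\<close>

definition exclusive_infs :: "'a sep_system \<Rightarrow> 'a set set \<Rightarrow> 'a set" where
  "exclusive_infs S \<P> = {m. \<exists>P\<in>\<P>. exclusive_inf S \<P> P m}"

definition nested_part :: "'a sep_system \<Rightarrow> 'a set set \<Rightarrow> 'a set" where
  "nested_part S \<P> = {s \<in> seps S. \<forall>m\<in>exclusive_infs S \<P>. \<not> crossing S s m}"

definition reduced_system :: "'a sep_system \<Rightarrow> 'a set set \<Rightarrow> 'a sep_system" where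
  "reduced_system S \<P> =
     \<lparr>seps = nested_part S \<P>, sle = sle S \<inter> nested_part S \<P> \<times> nested_part S \<P>, sinv = sinv S\<rparr>"

definition reduced_family :: "'a sep_system \<Rightarrow> 'a set set \<Rightarrow> 'a set set" where
  "reduced_family S \<P> = (\<lambda>P. P \<inter> nested_part S \<P>) ` {P \<in> \<P>. exclusive S \<P> P = {}}"

lemma reduced_sel [simp]:
  "seps (reduced_system S \<P>) = nested_part S \<P>"
  "sle (reduced_system S \<P>) = sle S \<inter> nested_part S \<P> \<times> nested_part S \<P>"
  "sinv (reduced_system S \<P>) = sinv S"
  "unoriented (reduced_system S \<P>) = unoriented S"
  by (auto simp: reduced_system_def unoriented_def)

text \<open>
  The first argument bounds the number of repetitions, since the recursion need not reach an empty
  family on arbitrary arguments. The cardinality of \<open>\<P>\<close> will be a sufficient bound.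
\<close>

primrec nested_family :: "nat \<Rightarrow> 'a sep_system \<Rightarrow> 'a set set \<Rightarrow> 'a set set" where
  "nested_family 0 S \<P> = {}"
| "nested_family (Suc n) S \<P> = unoriented S ` exclusive_infs S \<P> \<union>
     nested_family n (reduced_system S \<P>) (reduced_family S \<P>)"

lemma (in sep_sys) nested_part_star:
  assumes "exclusive_infs S \<P> \<subseteq> seps S" "s \<in> nested_part S \<P>"
  shows "s\<^sup>\<star> \<in> nested_part S \<P>"
  using assms by (auto simp: nested_part_def subset_iff)

lemma (in sep_sys) reduced_separation_system:
  assumes "exclusive_infs S \<P> \<subseteq> seps S"
  shows "separation_system (reduced_system S \<P>)"
  unfolding separation_system_def
proof (intro conjI ballI)
  show "partial_order_on (seps (reduced_system S \<P>)) (sle (reduced_system S \<P>))"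
    using le_refl le_trans le_antisym
    by (auto simp: partial_order_on_def preorder_on_def refl_on_def nested_part_def
        intro!: transI antisymI)
qed (use nested_part_star[OF assms] in \<open>auto simp: nested_part_def star_le_star\<close>)

context submodular_family
begin

lemma exclusive_infs_seps: "exclusive_infs S \<P> \<subseteq> seps S"
  using exclusiveD(2) by (auto simp: exclusive_infs_def exclusive_inf_def)

text \<open>
  The orientation of \<open>s\<close> is chosen so that \<open>s\<^sup>\<star>\<close>, not \<open>s\<close>, lies in \<open>R\<close>. Then for a maximal exclusive
  separation \<open>r\<close> of \<open>R\<close> that crosses \<open>s\<close>, the supremum of \<open>s\<^sup>\<star>\<close> and \<open>r\<close> would lie in \<open>R\<close> and
  contradict the maximality of \<open>r\<close>. So submodularity provides the supremum of \<open>s\<close> and \<open>r\<^sup>\<star>\<close>, which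
  replaces \<open>s\<close>. As \<open>s\<close> only grows, what has been achieved for other maximal exclusive separations
  of \<open>R\<close> is kept, although these may cross \<open>r\<close>. The set \<open>T\<close> stands for the infima that \<open>s\<close> has been
  made nested with before.

  The condition \<open>s \<noteq> s\<^sup>\<star>\<close> matters: a separation equal to its inverse lies in all orientations and
  distinguishes every two of them in name only.
\<close>

lemma distinguished_towards_max_exclusive:
  assumes R: "R \<in> \<P>" and P: "P \<in> \<P>" "P \<noteq> R" and Q: "Q \<in> \<P>" "Q \<noteq> R"
    and s: "s \<in> P" "s\<^sup>\<star> \<in> Q" "s \<noteq> s\<^sup>\<star>" "s\<^sup>\<star> \<in> R"
    and T: "T \<subseteq> seps S" "\<And>t. t \<in> T \<Longrightarrow> \<not> crossing S s t"
      "\<And>t r. t \<in> T \<Longrightarrow> r \<in> M R \<Longrightarrow> \<not> crossing S r t"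
  shows "\<exists>s'. s' \<in> P \<and> s'\<^sup>\<star> \<in> Q \<and> s' \<noteq> s'\<^sup>\<star> \<and>
    (\<forall>t\<in>T. \<not> crossing S s' t) \<and> (\<forall>r\<in>M R. s'\<^sup>\<star> \<preceq> r)"
proof -
  have fin: "finite (M R)"
    using finite_seps max_exclusiveD(3)[OF R] by (meson finite_subset subsetI)
  have "\<exists>s'. s' \<in> P \<and> s'\<^sup>\<star> \<in> Q \<and> s' \<noteq> s'\<^sup>\<star> \<and> s'\<^sup>\<star> \<in> R \<and>
     (\<forall>t\<in>T. \<not> crossing S s' t) \<and> (\<forall>r\<in>F. s'\<^sup>\<star> \<preceq> r)"
    if "finite F" "F \<subseteq> M R" for F
    using that
  proof (induction F rule: finite_induct)
    case empty
    then show ?case using s T(2) by (intro exI[of _ s]) simp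
  next
    case (insert r F)
    then obtain x where x: "x \<in> P" "x\<^sup>\<star> \<in> Q" "x\<^sup>\<star> \<in> R" "\<forall>t\<in>T. \<not> crossing S x t"
      "\<forall>r\<in>F. x\<^sup>\<star> \<preceq> r" "x \<noteq> x\<^sup>\<star>" by auto
    have rM: "r \<in> M R" using insert.prems by simp
    note r = max_exclusiveD[OF R rM]
    note rE = exclusiveD(3,4)[OF R r(1)]
    have xs: "x \<in> seps S" using x(1) P mem_seps by blast
    show ?case
    proof (cases "x\<^sup>\<star> \<preceq> r")
      case True
      then show ?thesis using x by (intro exI[of _ x]) auto
    next
      case False
      have "crossing S x r"
      proof (rule ccontr)
        assume "\<not> crossing S x r"
        then consider "x \<preceq> r" | "r \<preceq> x" | "r \<preceq> x\<^sup>\<star>"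
          using False crossing_iff[OF xs r(3)] le_star xs r(3) by blast
        then show False
        proof cases
          case 1
          then consider "x \<in> R" | "x = r\<^sup>\<star>" using down_closed[OF R r(2)] by blast
          then show False
            using star_mem_iff[OF R xs] x(3) 1 False r(3) le_refl by cases auto
        next
          case 2
          then show False using down_closed[OF P(1) x(1)] rE(1) P Q x(2) by blast
        next
          case 3
          then show False using down_closed[OF Q(1) x(2)] rE(1) P Q x(1) xs by auto
        qed
      qed
      then have cr: "crossing S x (r\<^sup>\<star>)" using xs r(3) by simp
      with xs star_in[OF r(3)] show ?thesis
      proof (cases rule: crossing_cases)
        case (join j)
        note j = profile_joinD[OF join]
        have jP: "j \<in> P" using j(4)[OF P(1) x(1)] rE(2) P by blast
        have js: "j\<^sup>\<star> \<preceq> x\<^sup>\<star>" "j\<^sup>\<star> \<preceq> r" using j(1-3) xs r(3) star_le_star star_le by auto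
        have "j\<^sup>\<star> \<noteq> x\<^sup>\<star>\<^sup>\<star>"
          using js(2) cr xs r(3) by (auto simp: crossing_iff)
        then have "j\<^sup>\<star> \<in> Q" "j\<^sup>\<star> \<in> R"
          using down_closed[OF Q(1) x(2) js(1)] down_closed[OF R x(3) js(1)] by auto
        \<comment> \<open>Otherwise \<open>r\<^sup>\<star>\<close> would lie below \<open>j = j\<^sup>\<star>\<close> and so below \<open>x\<^sup>\<star>\<close>, although \<open>x\<close> and \<open>r\<close> cross.\<close>
        moreover have "j \<noteq> j\<^sup>\<star>"
          using js(2) j(2) le_trans cr xs r(3) by (metis crossing_iff crossing_star(2))
        moreover have "\<not> crossing S j t" if "t \<in> T" for t
        proof (rule join_of_crossing_nested[OF _ cr xs])
          show "is_join S x (r\<^sup>\<star>) j" using join by (simp add: profile_join_def)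
        qed (use that T r(3) rM x(4) in auto)
        moreover have "j\<^sup>\<star> \<preceq> f" if "f \<in> F" for f using js(1) x(5) that le_trans by blast
        ultimately show ?thesis using jP js(2) by auto
      next
        case (join_star j)
        then have "profile_join S \<P> (x\<^sup>\<star>) r j" using r(3) by simp
        note j = profile_joinD[OF this]
        have "j = r" using r(4) j(3) j(4)[OF R x(3) r(2)] by blast
        then show ?thesis using j(2) False by blast
      qed
    qed
  qed
  from this[OF fin order_refl] show ?thesis by blast
qed

text \<open>
  The orientations that have exclusive separations are treated one after the other. If \<open>s\<close> rather
  than \<open>s\<^sup>\<star>\<close> lies in the current one, the roles of \<open>P\<close> and \<open>Q\<close> are exchanged. A separation whose
  inverse lies below all maximal exclusive separations lies above the inverse of their infimum.
\<close>

lemma distinguished_by_nested_part: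
  assumes "P \<in> \<P>" "Q \<in> \<P>" "P \<noteq> Q" "E P = {}" "E Q = {}"
  obtains s where "s \<in> nested_part S \<P>" "s \<in> P" "s \<notin> Q"
proof -
  have ex: "\<exists>s. s \<in> P \<and> s\<^sup>\<star> \<in> Q \<and> s \<noteq> s\<^sup>\<star> \<and>
    (\<forall>R\<in>\<R>. \<forall>m. exclusive_inf S \<P> R m \<longrightarrow> \<not> crossing S s m)"
    if "finite \<R>" "\<R> \<subseteq> {R \<in> \<P>. E R \<noteq> {}}" for \<R>
    using that
  proof (induction \<R> rule: finite_induct)
    case empty
    obtain x where "x \<in> P \<and> x \<notin> Q \<or> x \<in> Q \<and> x \<notin> P" using assms(3) by blast
    then have "x \<in> seps S" "x \<in> P \<and> x\<^sup>\<star> \<in> Q \<or> x\<^sup>\<star> \<in> P \<and> x\<^sup>\<star>\<^sup>\<star> \<in> Q" "x \<noteq> x\<^sup>\<star>"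
      using assms(1,2) mem_seps star_mem_iff star_star by metis+
    then show ?case by (metis empty_iff star_star)
  next
    case (insert R \<R>)
    define T where "T = {m. \<exists>R\<in>\<R>. exclusive_inf S \<P> R m}"
    have Tinf: "T \<subseteq> exclusive_infs S \<P>" using insert.prems unfolding T_def exclusive_infs_def by blast
    then have Ts: "T \<subseteq> seps S" using exclusive_infs_seps by blast
    have R: "R \<in> \<P>" "R \<noteq> P" "R \<noteq> Q" using insert.prems assms by auto
    obtain s where s: "s \<in> P" "s\<^sup>\<star> \<in> Q" "s \<noteq> s\<^sup>\<star>" "\<And>t. t \<in> T \<Longrightarrow> \<not> crossing S s t"
      using insert unfolding T_def by blast
    have ss: "s \<in> seps S" using s(1) assms(1) mem_seps by blast
    have MT: "\<not> crossing S r t" if tr: "t \<in> T" "r \<in> M R" for r t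
    proof -
      obtain R' where R': "R' \<in> \<R>" "exclusive_inf S \<P> R' t" using tr(1) unfolding T_def by blast
      then have "R' \<in> \<P>" "R \<noteq> R'" using insert by auto
      then have "r\<^sup>\<star> \<preceq> t" using max_exclusive_towards_inf R(1) R'(2) tr(2) by blast
      then show ?thesis using crossing_iff max_exclusiveD(3)[OF R(1) tr(2)] tr(1) Ts by blast
    qed
    obtain s' where s': "s' \<in> P" "s'\<^sup>\<star> \<in> Q" "s' \<noteq> s'\<^sup>\<star>" "\<And>t. t \<in> T \<Longrightarrow> \<not> crossing S s' t"
      "(\<forall>r\<in>M R. s'\<^sup>\<star> \<preceq> r) \<or> (\<forall>r\<in>M R. s' \<preceq> r)"
    proof (cases "s\<^sup>\<star> \<in> R")
      case True
      obtain y where y: "y \<in> P" "y\<^sup>\<star> \<in> Q" "y \<noteq> y\<^sup>\<star>" "\<forall>t\<in>T. \<not> crossing S y t"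
        "\<forall>r\<in>M R. y\<^sup>\<star> \<preceq> r"
        using distinguished_towards_max_exclusive[of R P Q s T, OF R(1) assms(1) R(2)[symmetric]
          assms(2) R(3)[symmetric] s(1-3) True Ts s(4) MT] by blast
      show ?thesis by (rule that[OF y(1-3)]) (use y(4,5) in auto)
    next
      case False
      then have sR: "s\<^sup>\<star>\<^sup>\<star> \<in> R" using star_mem_iff[OF R(1) ss] ss by auto
      have sP: "s\<^sup>\<star>\<^sup>\<star> \<in> P" using s(1) ss by simp
      have sT: "\<not> crossing S (s\<^sup>\<star>) t" if "t \<in> T" for t using s(4) that ss Ts by auto
      have sne: "s\<^sup>\<star> \<noteq> s\<^sup>\<star>\<^sup>\<star>" using s(3) ss by simp
      obtain y where y: "y \<in> Q" "y\<^sup>\<star> \<in> P" "y \<noteq> y\<^sup>\<star>" "\<forall>t\<in>T. \<not> crossing S y t"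
        "\<forall>r\<in>M R. y\<^sup>\<star> \<preceq> r"
        using distinguished_towards_max_exclusive[of R Q P "s\<^sup>\<star>" T, OF R(1) assms(2) R(3)[symmetric]
          assms(1) R(2)[symmetric] s(2) sP sne sR Ts sT MT] by blast
      have ys: "y \<in> seps S" using y(1) assms(2) mem_seps by blast
      have yT: "\<not> crossing S (y\<^sup>\<star>) t" if "t \<in> T" for t using y(4) that ys Ts by auto
      show ?thesis
      proof (rule that)
        show "y\<^sup>\<star> \<in> P" "y\<^sup>\<star>\<^sup>\<star> \<in> Q" "y\<^sup>\<star> \<noteq> y\<^sup>\<star>\<^sup>\<star>" using y(1-3) ys by simp_all
        show "(\<forall>r\<in>M R. y\<^sup>\<star>\<^sup>\<star> \<preceq> r) \<or> (\<forall>r\<in>M R. y\<^sup>\<star> \<preceq> r)" using y(5) by blast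
      qed (rule yT)
    qed
    have s's: "s' \<in> seps S" using s'(1) assms(1) mem_seps by blast
    have "\<not> crossing S s' m" if "exclusive_inf S \<P> R m" for m
    proof -
      have ms: "m \<in> seps S" using that exclusiveD(2)[OF R(1)] unfolding exclusive_inf_def by blast
      have "s'\<^sup>\<star> \<preceq> m \<or> s' \<preceq> m" using that s'(5) s's unfolding exclusive_inf_def by auto
      then show ?thesis using crossing_iff s's ms by blast
    qed
    then show ?case using s' unfolding T_def by auto
  qed
  obtain s where s: "s \<in> P" "s\<^sup>\<star> \<in> Q" "s \<noteq> s\<^sup>\<star>"
    "\<And>R m. R \<in> \<P> \<Longrightarrow> E R \<noteq> {} \<Longrightarrow> exclusive_inf S \<P> R m \<Longrightarrow> \<not> crossing S s m"
    using ex[of "{R \<in> \<P>. E R \<noteq> {}}"] finite_family by auto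
  have "s \<in> nested_part S \<P>"
    using s assms(1) mem_seps unfolding nested_part_def exclusive_infs_def exclusive_inf_def by blast
  moreover have "s \<notin> Q"
    using s star_mem_iff assms(1,2) mem_seps star_in star_star by metis
  ultimately show ?thesis using that s by blast
qed

lemma crossing_reduced:
  assumes "r \<in> nested_part S \<P>" "s \<in> nested_part S \<P>"
  shows "crossing (reduced_system S \<P>) r s \<longleftrightarrow> crossing S r s"
  using assms nested_part_star[OF exclusive_infs_seps]
  by (auto simp: crossing_def nested_def unoriented_def)

lemma profile_join_reduced:
  assumes "profile_join S \<P> r s j" "crossing S r s" "r \<in> nested_part S \<P>" "s \<in> nested_part S \<P>"
  shows "profile_join (reduced_system S \<P>) (reduced_family S \<P>) r s j"
proof -
  have j: "is_join S r s j" using assms(1) by (simp add: profile_join_def)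
  have "\<not> crossing S j m" if "m \<in> exclusive_infs S \<P>" for m
    using join_of_crossing_nested[OF j assms(2)] assms(3,4) that exclusive_infs_seps
    by (auto simp: nested_part_def)
  then have "j \<in> nested_part S \<P>" using profile_joinD(1)[OF assms(1)] by (simp add: nested_part_def)
  then show ?thesis using assms
    by (auto simp: profile_join_def is_join_def reduced_family_def nested_part_def)
qed

lemma reduced_instance: "submodular_instance (reduced_system S \<P>) (reduced_family S \<P>)"
proof -
  let ?U = "nested_part S \<P>"
  interpret red: sep_sys "reduced_system S \<P>"
    by unfold_locales (rule reduced_separation_system[OF exclusive_infs_seps])
  have U: "?U \<subseteq> seps S" by (auto simp: nested_part_def)
  note Ustar = nested_part_star[OF exclusive_infs_seps]
  have "orientation (reduced_system S \<P>) (P \<inter> ?U) \<and> consistent (reduced_system S \<P>) (P \<inter> ?U)"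
    if P: "P \<in> \<P>" for P
  proof
    have "\<exists>!a. a \<in> unoriented S s \<and> a \<in> P \<inter> ?U" if "s \<in> ?U" for s
      using star_mem_iff[OF P, of s] Ustar[OF that] that U by (auto simp: unoriented_def)
    then show "orientation (reduced_system S \<P>) (P \<inter> ?U)"
      by (auto simp: orientation_def unoriented_seps_def)
    show "consistent (reduced_system S \<P>) (P \<inter> ?U)"
      using inst P unfolding submodular_instance_def consistent_def by auto
  qed
  moreover have "submodular (reduced_system S \<P>) (reduced_family S \<P>)"
    unfolding red.submodular_iff_joins
  proof (intro ballI impI)
    fix r s assume rs: "r \<in> seps (reduced_system S \<P>)" "s \<in> seps (reduced_system S \<P>)"
      and "crossing (reduced_system S \<P>) r s"
    then have c: "crossing S r s" and rsS: "r \<in> seps S" "s \<in> seps S"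
      using crossing_reduced U by auto
    from rsS c show "(\<exists>j. profile_join (reduced_system S \<P>) (reduced_family S \<P>) r s j) \<or>
      (\<exists>j. profile_join (reduced_system S \<P>) (reduced_family S \<P>)
         (sinv (reduced_system S \<P>) r) (sinv (reduced_system S \<P>) s) j)"
    proof (cases rule: crossing_cases)
      case (join j)
      then show ?thesis using profile_join_reduced c rs by auto
    next
      case (join_star j)
      then show ?thesis using profile_join_reduced[OF join_star] c rs rsS Ustar by auto
    qed
  qed
  ultimately show ?thesis
    using red.sep_sys finite_seps U
    by (auto simp: submodular_instance_def reduced_family_def intro: finite_subset)
qed

end

section \<open>The nested set\<close>

lemma nested_reducedD: "nested (reduced_system S \<P>) r s \<Longrightarrow> nested S r s"
  by (auto simp: nested_def)

lemma nested_family_subset: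
  assumes "submodular_instance S \<P>"
  shows "nested_family n S \<P> \<subseteq> unoriented_seps S"
  using assms
proof (induction n arbitrary: S \<P>)
  case (Suc n)
  interpret submodular_family S \<P> using Suc.prems by (simp add: submodular_family_iff)
  have "unoriented_seps (reduced_system S \<P>) \<subseteq> unoriented_seps S"
    unfolding unoriented_seps_def reduced_sel nested_part_def by blast
  moreover have "unoriented S ` exclusive_infs S \<P> \<subseteq> unoriented_seps S"
    unfolding unoriented_seps_def using exclusive_infs_seps by (rule image_mono)
  ultimately show ?case using Suc.IH[OF reduced_instance] unfolding nested_family.simps by blast
qed simp

lemma nested_family_nested:
  assumes "submodular_instance S \<P>"
  shows "nested_set S (nested_family n S \<P>)"
  using assms
proof (induction n arbitrary: S \<P>)
  case (Suc n)
  interpret submodular_family S \<P> using Suc.prems by (simp add: submodular_family_iff)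
  let ?A = "unoriented S ` exclusive_infs S \<P>"
  let ?B = "nested_family n (reduced_system S \<P>) (reduced_family S \<P>)"
  have BB: "nested S r s" if "r \<in> ?B" "s \<in> ?B" for r s
    using Suc.IH[OF reduced_instance] that nested_reducedD unfolding nested_set_def by blast
  have AA: "nested S r s" if "r \<in> ?A" "s \<in> ?A" for r s
    using that exclusive_inf_not_crossing unfolding exclusive_infs_def crossing_def by blast
  have AB: "nested S r s \<and> nested S s r" if r: "r \<in> ?A" and s: "s \<in> ?B" for r s
  proof -
    obtain m where m: "r = unoriented S m" "m \<in> exclusive_infs S \<P>" using r by blast
    obtain x where x: "s = unoriented S x" "x \<in> nested_part S \<P>"
      using nested_family_subset[OF reduced_instance] s unfolding unoriented_seps_def reduced_sel by blast
    have "\<not> crossing S x m" "x \<in> seps S" "m \<in> seps S"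
      using m(2) x(2) exclusive_infs_seps unfolding nested_part_def by blast+
    then show ?thesis using crossing_commute[of x m] unfolding m(1) x(1) crossing_def by blast
  qed
  show ?case
    unfolding nested_set_def
  proof (intro ballI)
    fix r s assume rs: "r \<in> nested_family (Suc n) S \<P>" "s \<in> nested_family (Suc n) S \<P>"
    then have "r \<in> ?A \<or> r \<in> ?B" "s \<in> ?A \<or> s \<in> ?B" by simp_all
    then show "nested S r s" using AA[of r s] BB[of r s] AB[of r s] AB[of s r] by argo
  qed
qed (simp add: nested_set_def)

text \<open>
  Two orientations without exclusive separations have distinct restrictions to the nested part, so
  the induction hypothesis distinguishes them; the family has become smaller by \<open>two_exclusive\<close>.
\<close>

lemma nested_family_distinguishes:
  assumes "submodular_instance S \<P>" "card \<P> \<le> n"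
  shows "distinguishes_all S (nested_family n S \<P>) \<P>"
  using assms
proof (induction n arbitrary: S \<P>)
  case 0
  then interpret submodular_family S \<P> by (simp add: submodular_family_iff)
  show ?case using 0 finite_family by (simp add: distinguishes_all_def)
next
  case (Suc n)
  interpret submodular_family S \<P> using Suc.prems by (simp add: submodular_family_iff)
  show ?case unfolding distinguishes_all_def
  proof (intro ballI impI)
    fix P Q assume PQ: "P \<in> \<P>" "Q \<in> \<P>" "P \<noteq> Q"
    have at_exclusive: "\<exists>m\<in>exclusive_infs S \<P>. m \<in> X \<and> sinv S m \<in> Y"
      if XY: "X \<in> \<P>" "Y \<in> \<P>" "Y \<noteq> X" "E X \<noteq> {}" for X Y
    proof -
      obtain m where m: "exclusive_inf S \<P> X m" using exclusive_inf_exists[OF XY] .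
      then have "m \<in> X" "sinv S m \<in> Y"
        using exclusiveD(1,4)[OF XY(1)] XY unfolding exclusive_inf_def by auto
      then show ?thesis using m XY(1) unfolding exclusive_infs_def by blast
    qed
    consider (P) "E P \<noteq> {}" | (Q) "E Q \<noteq> {}" | (none) "E P = {}" "E Q = {}" by blast
    then show "\<exists>s\<in>nested_family (Suc n) S \<P>. distinguishes S s P Q"
    proof cases
      case P
      then obtain m where "m \<in> exclusive_infs S \<P>" "m \<in> P" "sinv S m \<in> Q"
        using at_exclusive[of P Q] PQ by blast
      then show ?thesis
        by (intro bexI[of _ "unoriented S m"]) (auto simp: distinguishes_def unoriented_def)
    next
      case Q
      then obtain m where "m \<in> exclusive_infs S \<P>" "m \<in> Q" "sinv S m \<in> P"
        using at_exclusive[of Q P] PQ by blast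
      then show ?thesis using mem_seps[OF PQ(2)]
        by (intro bexI[of _ "unoriented S m"]) (auto simp: distinguishes_def unoriented_def)
    next
      case none
      let ?U = "nested_part S \<P>"
      have red: "P \<inter> ?U \<in> reduced_family S \<P>" "Q \<inter> ?U \<in> reduced_family S \<P>"
        using none PQ by (auto simp: reduced_family_def)
      have ne: "P \<inter> ?U \<noteq> Q \<inter> ?U"
        using distinguished_by_nested_part[OF PQ none] by blast
      obtain X where X: "X \<in> \<P>" "E X \<noteq> {}" using two_exclusive[OF inst PQ] by blast
      have "card (reduced_family S \<P>) \<le> card {P \<in> \<P>. E P = {}}"
        unfolding reduced_family_def using finite_family by (intro card_image_le) simp
      also have "\<dots> < card \<P>" using X finite_family by (intro psubset_card_mono) auto
      finally have "card (reduced_family S \<P>) \<le> n" using Suc.prems(2) by simp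
      note Suc.IH[OF reduced_instance this, unfolded distinguishes_all_def, rule_format, OF red ne]
      then obtain s where "s \<in> nested_family n (reduced_system S \<P>) (reduced_family S \<P>)"
        "distinguishes (reduced_system S \<P>) s (P \<inter> ?U) (Q \<inter> ?U)" by blast
      moreover from this(2) have "distinguishes S s P Q"
        unfolding distinguishes_def reduced_sel by blast
      ultimately show ?thesis unfolding nested_family.simps by blast
    qed
  qed
qed

section \<open>Isomorphisms\<close>

locale sep_isomorphism =
  fixes \<phi> :: "'a \<Rightarrow> 'b" and S S' and \<P> :: "'a set set"
  assumes iso: "sep_iso \<phi> S S'"
    and sys: "separation_system S"
    and family: "\<P> \<subseteq> Pow (seps S)"
begin

abbreviation "\<P>' \<equiv> (`) \<phi> ` \<P>"

lemma image_seps: "seps S' = \<phi> ` seps S"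
  using iso by (auto simp: sep_iso_def bij_betw_def)

lemma inj: "inj_on \<phi> (seps S)"
  using iso by (auto simp: sep_iso_def bij_betw_def)

lemma star_phi: "s \<in> seps S \<Longrightarrow> sinv S' (\<phi> s) = \<phi> (sinv S s)"
  using iso by (auto simp: sep_iso_def)

lemma le_phi: "r \<in> seps S \<Longrightarrow> s \<in> seps S \<Longrightarrow> (\<phi> r, \<phi> s) \<in> sle S' \<longleftrightarrow> (r, s) \<in> sle S"
  using iso by (auto simp: sep_iso_def)

lemma unoriented_phi: "s \<in> seps S \<Longrightarrow> unoriented S' (\<phi> s) = \<phi> ` unoriented S s"
  by (simp add: unoriented_def star_phi)

lemma star_seps: "s \<in> seps S \<Longrightarrow> sinv S s \<in> seps S"
  using sys by (simp add: separation_system_def)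

lemma crossing_phi:
  assumes "r \<in> seps S" "s \<in> seps S"
  shows "crossing S' (\<phi> r) (\<phi> s) \<longleftrightarrow> crossing S r s"
  using assms by (simp add: crossing_def nested_def unoriented_def star_phi le_phi star_seps)

lemma exclusive_phi:
  assumes "P \<in> \<P>"
  shows "exclusive S' \<P>' (\<phi> ` P) = \<phi> ` exclusive S \<P> P"
proof -
  have mem: "\<phi> s \<in> \<phi> ` Q \<longleftrightarrow> s \<in> Q" if "s \<in> seps S" "Q \<in> \<P>" for s Q
    using inj_on_image_mem_iff[OF inj that(1)] that(2) family by blast
  have eq: "\<phi> ` Q = \<phi> ` P \<longleftrightarrow> Q = P" if "Q \<in> \<P>" for Q
    using inj_on_image_eq_iff[OF inj] that assms family by blast
  have "\<phi> s \<in> exclusive S' \<P>' (\<phi> ` P) \<longleftrightarrow> s \<in> exclusive S \<P> P" if "s \<in> P" for s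
  proof -
    have "s \<in> seps S" using that assms family by blast
    then show ?thesis using that mem eq assms unfolding exclusive_def by auto
  qed
  moreover have "exclusive S' \<P>' (\<phi> ` P) \<subseteq> \<phi> ` P" "exclusive S \<P> P \<subseteq> P"
    by (auto simp: exclusive_def)
  ultimately show ?thesis by blast
qed

lemma exclusive_seps: "P \<in> \<P> \<Longrightarrow> exclusive S \<P> P \<subseteq> seps S"
  using family unfolding exclusive_def by blast

lemma max_exclusive_phi:
  assumes "P \<in> \<P>"
  shows "max_exclusive S' \<P>' (\<phi> ` P) = \<phi> ` max_exclusive S \<P> P"
proof -
  have "\<phi> s = \<phi> r \<longleftrightarrow> s = r" if "s \<in> exclusive S \<P> P" "r \<in> exclusive S \<P> P" for s r
    using inj_on_eq_iff[OF inj] that exclusive_seps[OF assms] by blast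
  moreover have "(\<phi> r, \<phi> s) \<in> sle S' \<longleftrightarrow> (r, s) \<in> sle S"
    if "s \<in> exclusive S \<P> P" "r \<in> exclusive S \<P> P" for s r
    using le_phi that exclusive_seps[OF assms] by blast
  ultimately show ?thesis
    unfolding max_exclusive_def exclusive_phi[OF assms] by auto
qed

lemma exclusive_inf_phi:
  assumes "P \<in> \<P>" "m \<in> seps S"
  shows "exclusive_inf S' \<P>' (\<phi> ` P) (\<phi> m) \<longleftrightarrow> exclusive_inf S \<P> P m"
proof -
  have M: "max_exclusive S \<P> P \<subseteq> seps S"
    using exclusive_seps[OF assms(1)] unfolding max_exclusive_def by blast
  have "\<phi> m \<in> \<phi> ` exclusive S \<P> P \<longleftrightarrow> m \<in> exclusive S \<P> P"
    using inj_on_image_mem_iff[OF inj assms(2) exclusive_seps[OF assms(1)]] .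
  moreover have "(\<forall>r\<in>\<phi> ` max_exclusive S \<P> P. (\<phi> u, r) \<in> sle S') \<longleftrightarrow>
      (\<forall>r\<in>max_exclusive S \<P> P. (u, r) \<in> sle S)" if "u \<in> seps S" for u
    using le_phi[OF that] M by (simp add: subset_iff)
  ultimately show ?thesis
    unfolding exclusive_inf_def exclusive_phi[OF assms(1)] max_exclusive_phi[OF assms(1)] image_seps
    using le_phi assms(2) by simp
qed

lemma exclusive_infs_seps: "exclusive_infs S \<P> \<subseteq> seps S"
  using exclusive_seps unfolding exclusive_infs_def exclusive_inf_def by blast

lemma exclusive_infs_phi: "exclusive_infs S' \<P>' = \<phi> ` exclusive_infs S \<P>"
proof
  show "\<phi> ` exclusive_infs S \<P> \<subseteq> exclusive_infs S' \<P>'"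
    using exclusive_inf_phi exclusive_infs_seps unfolding exclusive_infs_def by blast
  show "exclusive_infs S' \<P>' \<subseteq> \<phi> ` exclusive_infs S \<P>"
  proof
    fix n assume "n \<in> exclusive_infs S' \<P>'"
    then obtain P where P: "P \<in> \<P>" "exclusive_inf S' \<P>' (\<phi> ` P) n"
      unfolding exclusive_infs_def by auto
    then have "n \<in> \<phi> ` exclusive S \<P> P"
      unfolding exclusive_inf_def exclusive_phi[OF P(1)] by blast
    then obtain m where m: "n = \<phi> m" "m \<in> exclusive S \<P> P" by blast
    then have "exclusive_inf S \<P> P m" using P exclusive_inf_phi exclusive_seps by blast
    then show "n \<in> \<phi> ` exclusive_infs S \<P>" using m(1) P(1) unfolding exclusive_infs_def by blast
  qed
qed

lemma nested_part_phi: "nested_part S' \<P>' = \<phi> ` nested_part S \<P>"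
proof -
  have "(\<forall>m\<in>\<phi> ` exclusive_infs S \<P>. \<not> crossing S' (\<phi> s) m) \<longleftrightarrow>
      (\<forall>m\<in>exclusive_infs S \<P>. \<not> crossing S s m)" if "s \<in> seps S" for s
    using crossing_phi[OF that] exclusive_infs_seps by (simp add: subset_iff)
  then show ?thesis unfolding nested_part_def exclusive_infs_phi image_seps by auto
qed

lemma reduced_family_phi: "reduced_family S' \<P>' = (`) \<phi> ` reduced_family S \<P>"
proof -
  let ?U = "nested_part S \<P>"
  have int: "\<phi> ` P \<inter> \<phi> ` ?U = \<phi> ` (P \<inter> ?U)" if "P \<in> \<P>" for P
    using inj_on_image_Int[OF inj, of P ?U] that family unfolding nested_part_def by blast
  have "{Q \<in> \<P>'. exclusive S' \<P>' Q = {}} = (`) \<phi> ` {P \<in> \<P>. exclusive S' \<P>' (\<phi> ` P) = {}}"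
    by blast
  also have "{P \<in> \<P>. exclusive S' \<P>' (\<phi> ` P) = {}} = {P \<in> \<P>. exclusive S \<P> P = {}}"
    by (intro Collect_cong conj_cong refl) (simp only: exclusive_phi image_is_empty)
  finally have eq: "{Q \<in> \<P>'. exclusive S' \<P>' Q = {}} = (`) \<phi> ` {P \<in> \<P>. exclusive S \<P> P = {}}" .
  show ?thesis
    unfolding reduced_family_def nested_part_phi eq image_image
    by (intro image_cong refl) (simp add: int)
qed

lemma reduced_iso: "sep_iso \<phi> (reduced_system S \<P>) (reduced_system S' \<P>')"
proof -
  have U: "nested_part S \<P> \<subseteq> seps S" by (auto simp: nested_part_def)
  then have "bij_betw \<phi> (nested_part S \<P>) (nested_part S' \<P>')"
    unfolding nested_part_phi by (intro inj_on_imp_bij_betw inj_on_subset[OF inj])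
  then show ?thesis
    unfolding sep_iso_def using U by (auto simp: star_phi le_phi nested_part_phi subset_iff)
qed

lemma card_family_phi: "card \<P>' = card \<P>"
  using inj_on_image_eq_iff[OF inj] family by (intro card_image inj_onI) blast

end

text \<open>
  The isomorphism restricts to one between the reduced systems, which carries the reduced
  families to each other, so the induction goes through for all systems at once.
\<close>

lemma nested_family_iso:
  assumes "sep_iso \<phi> S S'" "separation_system S" "\<P> \<subseteq> Pow (seps S)"
  shows "nested_family n S' ((`) \<phi> ` \<P>) = (`) \<phi> ` nested_family n S \<P>"
  using assms
proof (induction n arbitrary: S S' \<P>)
  case (Suc n)
  interpret sep_isomorphism \<phi> S S' \<P> using Suc.prems by unfold_locales
  interpret sep_sys S using Suc.prems(2) by unfold_locales
  have "reduced_family S \<P> \<subseteq> Pow (seps (reduced_system S \<P>))"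
    by (auto simp: reduced_family_def)
  from Suc.IH[OF reduced_iso reduced_separation_system[OF exclusive_infs_seps] this]
  have "nested_family n (reduced_system S' \<P>') (reduced_family S' \<P>') =
      (`) \<phi> ` nested_family n (reduced_system S \<P>) (reduced_family S \<P>)"
    unfolding reduced_family_phi .
  moreover have "unoriented S' ` exclusive_infs S' \<P>' = (`) \<phi> ` unoriented S ` exclusive_infs S \<P>"
    unfolding exclusive_infs_phi image_image
    using unoriented_phi exclusive_infs_seps by (intro image_cong) auto
  ultimately show ?case by (simp add: image_Un)
qed simp

definition distinguishing_family :: "'a sep_system \<Rightarrow> 'a set set \<Rightarrow> 'a set set" where
  "distinguishing_family S \<P> = nested_family (card \<P>) S \<P>"

lemma distinguishing_family_choice: "nested_distinguishing_choice distinguishing_family"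
  unfolding nested_distinguishing_choice_def distinguishing_family_def
  by (intro allI impI conjI nested_family_subset nested_family_nested nested_family_distinguishes order_refl)

lemma distinguishing_family_canonical: "iso_compatible distinguishing_family distinguishing_family"
  unfolding iso_compatible_def
proof (intro allI impI)
  fix S :: "'a sep_system" and \<P> and S' :: "'b sep_system" and \<phi>
  assume asm: "submodular_instance S \<P> \<and> separation_system S' \<and> sep_iso \<phi> S S'"
  interpret sep_isomorphism \<phi> S S' \<P>
    using asm by unfold_locales (auto simp: submodular_instance_def orientation_def)
  show "(`) \<phi> ` distinguishing_family S \<P> = distinguishing_family S' \<P>'"
    unfolding distinguishing_family_def card_family_phi nested_family_iso[OF iso sys family] ..
qed

theorem theorem3:
  shows "\<exists>(N :: 'a sep_system \<Rightarrow> 'a set set \<Rightarrow> 'a set set)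
          (N' :: 'b sep_system \<Rightarrow> 'b set set \<Rightarrow> 'b set set).
      nested_distinguishing_choice N \<and> nested_distinguishing_choice N' \<and>
      iso_compatible N N \<and> iso_compatible N N' \<and> iso_compatible N' N \<and> iso_compatible N' N'"
  by (intro exI[of _ distinguishing_family] conjI
      distinguishing_family_choice distinguishing_family_canonical)

end
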